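(* For any causal DAG $G$, $\mathcal{VVS}(G)\subseteq\mathcal{NM}(G)$.
   Context: **Causal DAGs.** A causal DAG $G(V,W,\mathcal E)$ is a finite directed acyclic graph with vertex set $V\sqcup W$ and edge set $\mathcal E$. Each $v\in V$ carries an observed variable $X_v$ with a fixed finite alphabet $\mathcal X_v$; vertices in $W$ are latent (they may have parents). $X_S=(X_v)_{v\in S}$. A (probability) kernel $q(x_A|x_B)$ is a non-negative function with $\sum_{x_A}q(x_A|x_B)=1$ for every $x_B$. **Ordinary Markov model.** $\mathcal I(G)$ is the set of distributions $p(X_V)$ such that for all disjoint $A,B,C\subseteq V$ with $A,B$ $d$-separated by $C$ in $G$ (standard $d$-separation, paths may pass through latent vertices), $X_A\perp X_B\mid X_C$. If $S$ is a set of parentless observed vertices of a DAG with observed set $V\sqcup S$, a kernel $q(X_V|X_S)$ is said to be in $\mathcal I$ of that DAG if the joint distribution in which the variables $X_s$, $s\in S$, are independent and uniform and $X_V$ given $X_S$ is distributed as $q$ is in it. **Visible vertex splitting.** Let $V_{\rm split}\subseteq V$ be the observed vertices having both an incoming and an outgoing edge. $\mathsf{VVSplit}(G)$ has observed vertices $V\cup V^\#$ with $V^\#=\{v^\#:v\in V_{\rm split}\}$ new parentless vertices ($X_{v^\#}$ has the alphabet of $X_v$), latent vertices $W$, and edges obtained from $\mathcal E$ by replacing each edge $v\to y$, $v\in V_{\rm split}$, by $v^\#\to y$. The projection of a kernel $q(X_V|X_{V^\#})$ is $\mathsf{Proj}(q)(x_V)=q(x_V\mid X_{v^\#}=x_v\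 \forall v\in V_{\rm split})$. $\mathcal{VVS}(G)=\{\mathsf{Proj}(q): q(X_V|X_{V^\#})\in\mathcal I(\mathsf{VVSplit}(G))\}$. **Nested Markov model.** For distinct observed $u,v$ write $u\Rightarrow v$ if there is a directed path from $u$ to $v$ all of whose intermediate vertices are latent, and $u\leftrightarrow v$ if some latent $w$ has directed paths to $u$ and to $v$ all of whose non-final vertices are latent. This gives a mixed graph $H(G)$ on $V$. More generally let $H$ be such a mixed graph on $R\sqcup F$ ($R$ random, $F$ fixed; fixed vertices have no incoming $\Rightarrow$ and no $\leftrightarrow$), with $\mathrm{pa}_H,\mathrm{ch}_H$ (parents, children) referring to $\Rightarrow$. Districts of $H$ are the connected components of $R$ under $\leftrightarrow$. For a district $D$, $H[D]$ has random vertices $D$, fixed vertices $\mathrm{pa}_H(D)\setminus D$, all edges $u\Rightarrow v$ of $H$ with $v\in D$, and all $\leftrightarrow$ within $D$. A kernel $p(x_R|x_F)$ obeys the nested Markov property with respect to $H$ if $R=\emptyset$, or both: (i) with $D_1,\dots,D_l$ the districts of $H$, there are kernels $g_i$ with $p(x_R|x_F)=\prod_{i=1}^l g_i(x_{D_i}|x_{\mathrm{pa}_H(D_i)\setminus D_i})$, where, if $l\ge2$ or $F\setminus\mathrm{pa}_H(R)\neq\emptyset$, every $g_i$ obeys the nested Markov property with respect to $H[D_i]$; (ii) for every $v\in R$ with $\mathrm{ch}_H(v)=\emptyset$, the marginal kernel $\sum_{x_v}p(x_R|x_F)$ obeys the nested Markov property with respect to $H$ with $v$ deleted (same fixed set $F$).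 $\mathcal{NM}(G)$ is the set of distributions $p(X_V)$ obeying the nested Markov property with respect to $H(G)$ with $R=V$, $F=\emptyset$. *)

theory Defs
  imports Complex_Main "HOL-Library.FuncSet"
begin

section \<open>Causal DAGs and kernels\<close>

record ('v, 'a) causal_dag =
  obs :: "'v set"
  lat :: "'v set"
  edges :: "('v \<times> 'v) set"
  alph :: "'v \<Rightarrow> 'a set"

definition causal_dag :: "('v, 'a) causal_dag \<Rightarrow> bool" where
  "causal_dag G \<longleftrightarrow>
     finite (obs G) \<and> finite (lat G) \<and> obs G \<inter> lat G = {} \<and>
     edges G \<subseteq> (obs G \<union> lat G) \<times> (obs G \<union> lat G) \<and> acyclic (edges G) \<and>
     (\<forall>v\<in>obs G. finite (alph G v) \<and> alph G v \<noteq> {})"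

text \<open>
  A joint value of the variables in \<open>S\<close> is an element of \<open>Pi\<^sub>E S X\<close>, where \<open>X\<close> gives the alphabets.
  A kernel \<open>q(x\<^sub>A|x\<^sub>B)\<close> with \<open>A\<close>, \<open>B\<close> disjoint is a function of the joint value of \<open>A \<union> B\<close>;
  being extensional, it carries no information outside this domain.
\<close>

definition kernels :: "('v \<Rightarrow> 'a set) \<Rightarrow> 'v set \<Rightarrow> 'v set \<Rightarrow> (('v \<Rightarrow> 'a) \<Rightarrow> real) set" where
  "kernels X A B =
     {q \<in> Pi\<^sub>E (A \<union> B) X \<rightarrow>\<^sub>E {0..}.
        \<forall>b\<in>Pi\<^sub>E B X. (\<Sum>x | x \<in> Pi\<^sub>E (A \<union> B) X \<and> restrict x B = b. q x) = 1}"

abbreviation distributions :: "('v \<Rightarrow> 'a set) \<Rightarrow> 'v set \<Rightarrow> (('v \<Rightarrow> 'a) \<Rightarrow> real) set" where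
  "distributions X V \<equiv> kernels X V {}"


section \<open>The ordinary Markov model\<close>

definition is_path :: "('v \<times> 'v) set \<Rightarrow> 'v list \<Rightarrow> bool" where
  "is_path E p \<longleftrightarrow> p \<noteq> [] \<and> distinct p \<and>
     (\<forall>i. Suc i < length p \<longrightarrow> (p ! i, p ! Suc i) \<in> E \<or> (p ! Suc i, p ! i) \<in> E)"

definition collider :: "('v \<times> 'v) set \<Rightarrow> 'v list \<Rightarrow> nat \<Rightarrow> bool" where
  "collider E p i \<longleftrightarrow> (p ! (i - 1), p ! i) \<in> E \<and> (p ! Suc i, p ! i) \<in> E"

text \<open>Since \<open>E\<^sup>*\<close> is reflexive, the descendants of a collider include the collider itself.\<close>

definition blocked :: "('v \<times> 'v) set \<Rightarrow> 'v set \<Rightarrow> 'v list \<Rightarrow> bool" where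
  "blocked E C p \<longleftrightarrow>
     (\<exists>i. 0 < i \<and> Suc i < length p \<and>
        (if collider E p i then \<forall>c\<in>C. (p ! i, c) \<notin> E\<^sup>* else p ! i \<in> C))"

definition d_separated :: "('v \<times> 'v) set \<Rightarrow> 'v set \<Rightarrow> 'v set \<Rightarrow> 'v set \<Rightarrow> bool" where
  "d_separated E A B C \<longleftrightarrow> (\<forall>p. is_path E p \<and> hd p \<in> A \<and> last p \<in> B \<longrightarrow> blocked E C p)"

text \<open>The probability, under the distribution \<open>p\<close> of \<open>X\<^sub>V\<close>, that \<open>X\<^sub>S\<close> agrees with \<open>x\<close> on \<open>S\<close>.\<close>

definition marginal ::
  "('v \<Rightarrow> 'a set) \<Rightarrow> 'v set \<Rightarrow> (('v \<Rightarrow> 'a) \<Rightarrow> real) \<Rightarrow> 'v set \<Rightarrow> ('v \<Rightarrow> 'a) \<Rightarrow> real" where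
  "marginal X V p S x = (\<Sum>y | y \<in> Pi\<^sub>E V X \<and> restrict y S = restrict x S. p y)"

definition cond_indep ::
  "('v \<Rightarrow> 'a set) \<Rightarrow> 'v set \<Rightarrow> (('v \<Rightarrow> 'a) \<Rightarrow> real) \<Rightarrow> 'v set \<Rightarrow> 'v set \<Rightarrow> 'v set \<Rightarrow> bool" where
  "cond_indep X V p A B C \<longleftrightarrow>
     (\<forall>x\<in>Pi\<^sub>E V X. marginal X V p C x > 0 \<longrightarrow>
        marginal X V p (A \<union> B \<union> C) x / marginal X V p C x =
        (marginal X V p (A \<union> C) x / marginal X V p C x) *
        (marginal X V p (B \<union> C) x / marginal X V p C x))"

definition markov_model :: "('v, 'a) causal_dag \<Rightarrow> (('v \<Rightarrow> 'a) \<Rightarrow> real) set" where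
  "markov_model G =
     {p \<in> distributions (alph G) (obs G).
        \<forall>A B C. A \<subseteq> obs G \<and> B \<subseteq> obs G \<and> C \<subseteq> obs G \<and>
          A \<inter> B = {} \<and> A \<inter> C = {} \<and> B \<inter> C = {} \<and> d_separated (edges G) A B C \<longrightarrow>
          cond_indep (alph G) (obs G) p A B C}"

text \<open>
  \<open>S\<close> is meant to be a set of parentless vertices in \<open>obs G\<close>; the inputs \<open>X\<^sub>S\<close> are made
  independent and uniform.
\<close>

definition markov_kernels :: "('v, 'a) causal_dag \<Rightarrow> 'v set \<Rightarrow> (('v \<Rightarrow> 'a) \<Rightarrow> real) set" where
  "markov_kernels G S =
     {q \<in> kernels (alph G) (obs G - S) S.
        (\<lambda>x\<in>Pi\<^sub>E (obs G) (alph G). (\<Prod>s\<in>S. 1 / real (card (alph G s))) * q x) \<in> markov_model G}"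


section \<open>Visible vertex splitting\<close>

text \<open>\<open>Orig v\<close> is the vertex \<open>v\<close> itself and \<open>Sharp v\<close> is its copy \<open>v\<^sup>#\<close>.\<close>

datatype 'v split_vertex = Orig 'v | Sharp 'v

definition split_vertices :: "('v, 'a) causal_dag \<Rightarrow> 'v set" where
  "split_vertices G = {v \<in> obs G. (\<exists>u. (u, v) \<in> edges G) \<and> (\<exists>y. (v, y) \<in> edges G)}"

definition VVSplit :: "('v, 'a) causal_dag \<Rightarrow> ('v split_vertex, 'a) causal_dag" where
  "VVSplit G =
     \<lparr>obs = Orig ` obs G \<union> Sharp ` split_vertices G,
      lat = Orig ` lat G,
      edges = {(Orig v, Orig y) | v y. (v, y) \<in> edges G \<and> v \<notin> split_vertices G} \<union>
              {(Sharp v, Orig y) | v y. (v, y) \<in> edges G \<and> v \<in> split_vertices G},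
      alph = case_split_vertex (alph G) (alph G)\<rparr>"

definition Proj ::
  "('v, 'a) causal_dag \<Rightarrow> (('v split_vertex \<Rightarrow> 'a) \<Rightarrow> real) \<Rightarrow> ('v \<Rightarrow> 'a) \<Rightarrow> real" where
  "Proj G q = (\<lambda>x\<in>Pi\<^sub>E (obs G) (alph G). q (restrict (case_split_vertex x x) (obs (VVSplit G))))"

definition VVS :: "('v, 'a) causal_dag \<Rightarrow> (('v \<Rightarrow> 'a) \<Rightarrow> real) set" where
  "VVS G = {Proj G q | q. q \<in> markov_kernels (VVSplit G) (Sharp ` split_vertices G)}"

lemma Sharp_parentless: "(u, Sharp v) \<notin> edges (VVSplit G)"
  by (simp add: VVSplit_def)

lemma causal_dag_VVSplit:
  assumes "causal_dag G"
  shows "causal_dag (VVSplit G)"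
proof -
  let ?f = "case_split_vertex (\<lambda>v. v) (\<lambda>v. v)"
  have step: "(?f a, ?f b) \<in> edges G" if "(a, b) \<in> edges (VVSplit G)" for a b
    using that by (auto simp: VVSplit_def)
  have "(?f a, ?f b) \<in> (edges G)\<^sup>+" if "(a, b) \<in> (edges (VVSplit G))\<^sup>+" for a b
    using that by (induction rule: trancl_induct) (auto dest: step intro: trancl_into_trancl)
  then have "acyclic (edges (VVSplit G))"
    using assms unfolding causal_dag_def acyclic_def by blast
  moreover have "split_vertices G \<subseteq> obs G"
    by (auto simp: split_vertices_def)
  ultimately show ?thesis
    using assms unfolding causal_dag_def
    by (auto simp: VVSplit_def intro: finite_subset)
qed


section \<open>The nested Markov model\<close>

record 'v mixed_graph =
  random :: "'v set"
  fixd :: "'v set"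
  dir :: "('v \<times> 'v) set"
  bidir :: "('v \<times> 'v) set"

text \<open>\<open>(u, v)\<close> such that some directed path from \<open>u\<close> to \<open>v\<close> has only latent intermediate vertices.\<close>

definition latent_paths :: "('v, 'a) causal_dag \<Rightarrow> ('v \<times> 'v) set" where
  "latent_paths G = (edges G \<inter> UNIV \<times> lat G)\<^sup>* O edges G"

definition mixed_graph_of :: "('v, 'a) causal_dag \<Rightarrow> 'v mixed_graph" where
  "mixed_graph_of G =
     \<lparr>random = obs G,
      fixd = {},
      dir = {(u, v). u \<in> obs G \<and> v \<in> obs G \<and> u \<noteq> v \<and> (u, v) \<in> latent_paths G},
      bidir = {(u, v). u \<in> obs G \<and> v \<in> obs G \<and> u \<noteq> v \<and>
                 (\<exists>w\<in>lat G. (w, u) \<in> latent_paths G \<and> (w, v) \<in> latent_paths G)}\<rparr>"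

definition pa :: "'v mixed_graph \<Rightarrow> 'v set \<Rightarrow> 'v set" where
  "pa H D = {u. \<exists>v\<in>D. (u, v) \<in> dir H}"

definition ch :: "'v mixed_graph \<Rightarrow> 'v \<Rightarrow> 'v set" where
  "ch H v = {y. (v, y) \<in> dir H}"

definition districts :: "'v mixed_graph \<Rightarrow> 'v set set" where
  "districts H = (\<lambda>v. {u \<in> random H. (v, u) \<in> (Restr (bidir H) (random H))\<^sup>*}) ` random H"

definition district_graph :: "'v mixed_graph \<Rightarrow> 'v set \<Rightarrow> 'v mixed_graph" where
  "district_graph H D =
     \<lparr>random = D, fixd = pa H D - D, dir = {(u, v) \<in> dir H. v \<in> D}, bidir = Restr (bidir H) D\<rparr>"

definition delete_vertex :: "'v mixed_graph \<Rightarrow> 'v \<Rightarrow> 'v mixed_graph" where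
  "delete_vertex H v =
     \<lparr>random = random H - {v}, fixd = fixd H,
      dir = Restr (dir H) (- {v}), bidir = Restr (bidir H) (- {v})\<rparr>"

definition sum_out ::
  "('v \<Rightarrow> 'a set) \<Rightarrow> 'v mixed_graph \<Rightarrow> 'v \<Rightarrow> (('v \<Rightarrow> 'a) \<Rightarrow> real) \<Rightarrow> ('v \<Rightarrow> 'a) \<Rightarrow> real" where
  "sum_out X H v p = (\<lambda>x\<in>Pi\<^sub>E (random H - {v} \<union> fixd H) X. \<Sum>a\<in>X v. p (x(v := a)))"

text \<open>
  Every recursive appeal to the property decreases \<open>(card (random H), card (fixd H))\<close>
  lexicographically when the graph is finite, so that the recursive characterisation has
  exactly one solution there and the inductive definition is that solution.
\<close>

inductive nested_markov ::
  "('v \<Rightarrow> 'a set) \<Rightarrow> 'v mixed_graph \<Rightarrow> (('v \<Rightarrow> 'a) \<Rightarrow> real) \<Rightarrow> bool"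
  for X :: "'v \<Rightarrow> 'a set" where
  no_random:
    "\<lbrakk>random H = {}; p \<in> kernels X (random H) (fixd H)\<rbrakk> \<Longrightarrow> nested_markov X H p"
| nested:
    "\<lbrakk>p \<in> kernels X (random H) (fixd H);
      \<forall>D\<in>districts H. g D \<in> kernels X D (pa H D - D);
      \<forall>x\<in>Pi\<^sub>E (random H \<union> fixd H) X. p x = (\<Prod>D\<in>districts H. g D (restrict x (D \<union> pa H D)));
      card (districts H) \<ge> 2 \<or> fixd H - pa H (random H) \<noteq> {} \<longrightarrow>
        (\<forall>D\<in>districts H. nested_markov X (district_graph H D) (g D));
      \<forall>v\<in>random H. ch H v = {} \<longrightarrow> nested_markov X (delete_vertex H v) (sum_out X H v p)\<rbrakk>
     \<Longrightarrow> nested_markov X H p"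

definition NM :: "('v, 'a) causal_dag \<Rightarrow> (('v \<Rightarrow> 'a) \<Rightarrow> real) set" where
  "NM G = {p \<in> distributions (alph G) (obs G). nested_markov (alph G) (mixed_graph_of G) p}"

end

theory Submission
  imports Defs
begin

text \<open>
  After the splitting, every observed vertex of \<open>VVSplit G\<close> is parentless or childless. Conditioning only on
  parentless vertices (the inputs) leaves no collider open, so the open paths are treks through latent
  vertices. Hence, given all inputs, the marginal of a set \<open>S\<close> of childless vertices depends only on the
  inputs of its parents in \<open>mixed_graph_of G\<close>, and it factorises over sets not joined by bidirected edges.
  Write \<open>Q S x y\<close> for this marginal at \<open>x\<close>, with the inputs set to \<open>y\<close>. The kernels reached in
  the recursion of the nested Markov property are exactly the diagonals \<open>x \<mapsto> Q R x x\<close>: on the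
  diagonal, summing out a childless vertex and factorising into districts commute with setting \<open>y = x\<close>.
\<close>

section \<open>Kernels with split inputs\<close>

text \<open>All that the nested Markov recursion needs to know about \<open>Q\<close>, detached from
  the DAG. Arbitrary functions \<open>x\<close>, \<open>y\<close> are allowed, so updates and
  restrictions of them need no side conditions.\<close>

locale split_kernel =
  fixes X :: "'v \<Rightarrow> 'a set" and H :: "'v mixed_graph"
    and Q :: "'v set \<Rightarrow> ('v \<Rightarrow> 'a) \<Rightarrow> ('v \<Rightarrow> 'a) \<Rightarrow> real"
  assumes finite_random: "finite (random H)"
    and finite_alph: "v \<in> random H \<Longrightarrow> finite (X v)"
    and fixd_empty: "fixd H = {}"
    and dir_sub: "dir H \<subseteq> random H \<times> random H"
    and acyclic_dir: "acyclic (dir H)"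
    and bidir_sub: "bidir H \<subseteq> random H \<times> random H"
    and sym_bidir: "sym (bidir H)"
    and nonneg: "0 \<le> Q S x y"
    and Q_empty: "Q {} x y = 1"
    and sum_single: "\<lbrakk>S \<subseteq> random H; v \<in> S\<rbrakk> \<Longrightarrow> (\<Sum>a\<in>X v. Q S (x(v := a)) y) = Q (S - {v}) x y"
    and cong_out: "\<lbrakk>S \<subseteq> random H; \<And>v. v \<in> S \<Longrightarrow> x v = x' v\<rbrakk> \<Longrightarrow> Q S x y = Q S x' y"
    and cong_in: "\<lbrakk>S \<subseteq> random H; \<And>v. v \<in> pa H S \<Longrightarrow> y v = y' v\<rbrakk> \<Longrightarrow> Q S x y = Q S x y'"
    and indep: "\<lbrakk>S \<subseteq> random H; T \<subseteq> random H; S \<inter> T = {}; bidir H \<inter> S \<times> T = {}\<rbrakk>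
      \<Longrightarrow> Q (S \<union> T) x y = Q S x y * Q T x y"
begin

definition K :: "'v set \<Rightarrow> 'v set \<Rightarrow> ('v \<Rightarrow> 'a) \<Rightarrow> real" where
  "K R F = (\<lambda>x\<in>Pi\<^sub>E (R \<union> F) X. Q R x x)"

section \<open>Normalisation of the diagonal kernels\<close>

lemma ex_childless:
  assumes "R \<subseteq> random H" "R \<noteq> {}"
  obtains v where "v \<in> R" "v \<notin> pa H R"
proof -
  have "finite (dir H)"
    using dir_sub finite_random by (meson finite_SigmaI finite_subset)
  then have "wf ((dir H)\<inverse>)"
    using acyclic_dir finite_acyclic_wf_converse by blast
  then obtain v where "v \<in> R" "\<And>y. (y, v) \<in> (dir H)\<inverse> \<Longrightarrow> y \<notin> R"
    using assms(2) by (metis wfE_min ex_in_conv)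
  then show thesis
    using that by (auto simp: pa_def)
qed

text \<open>As \<open>v\<close> is no parent of \<open>S\<close>, \<open>cong_in\<close> keeps the
  input at \<open>v\<close> fixed while the output at \<open>v\<close> is summed. Hence summing out
  may follow the identification of both arguments.\<close>

lemma Q_sum_diag:
  assumes "S \<subseteq> random H" "v \<in> S" "v \<notin> pa H S"
  shows "(\<Sum>a\<in>X v. Q S (x(v := a)) (x(v := a))) = Q (S - {v}) x x"
proof -
  have "Q S (x(v := a)) (x(v := a)) = Q S (x(v := a)) x" for a
    using assms by (intro cong_in) auto
  then show ?thesis
    using assms sum_single by simp
qed

text \<open>Acyclicity provides a vertex of \<open>R\<close> without a child in \<open>R\<close>.
  \<open>Q_sum_diag\<close> removes it, and the induction ends at
  \<open>Q {} x x = 1\<close>.\<close>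

lemma sum_Q_diag:
  assumes "finite R" "R \<subseteq> random H" "F \<inter> R = {}" "b \<in> Pi\<^sub>E F X"
  shows "(\<Sum>x | x \<in> Pi\<^sub>E (R \<union> F) X \<and> restrict x F = b. Q R x x) = 1"
  using assms
proof (induction "card R" arbitrary: R)
  case 0
  then have "{x. x \<in> Pi\<^sub>E (R \<union> F) X \<and> restrict x F = b} = {b}"
    by auto
  moreover have "R = {}" using 0 by simp
  ultimately show ?case by (simp only: Q_empty) simp
next
  case (Suc n)
  then obtain v where v: "v \<in> R" "v \<notin> pa H R"
    by (metis card.empty ex_childless nat.distinct(1))
  let ?R = "R - {v}"
  let ?A = "{x. x \<in> Pi\<^sub>E (?R \<union> F) X \<and> restrict x F = b}"
  have vF: "v \<notin> F" using Suc.prems v by blast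
  have ins: "insert v (?R \<union> F) = R \<union> F" using v by blast
  have upd: "restrict (x(v := a)) F = restrict x F" for x :: "'v \<Rightarrow> 'a" and a
    using vF by (auto simp: restrict_def)
  have "(\<Sum>x | x \<in> Pi\<^sub>E (R \<union> F) X \<and> restrict x F = b. Q R x x)
      = (\<Sum>(x, a)\<in>?A \<times> X v. Q R (x(v := a)) (x(v := a)))"
  \<comment> \<open>A joint value is split into its coordinate at \<open>v\<close> and the rest; the
    rest is \<open>undefined\<close> at \<open>v\<close> to be extensional on the smaller index
    set.\<close>
  proof (rule sum.reindex_bij_witness[where i = "\<lambda>(x, a). x(v := a)" and j = "\<lambda>x. (x(v := undefined), x v)"], goal_cases)
    case (1 x)
    then show ?case by simp
  next
    case (2 x)
    have "x(v := undefined) \<in> Pi\<^sub>E (?R \<union> F) X"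
      using 2 vF by (auto simp: PiE_def extensional_def Pi_def)
    then show ?case using 2 v by (auto simp: upd)
  next
    case (3 s)
    obtain x a where s: "s = (x, a)" by (cases s)
    have "x v = undefined" using 3 vF unfolding s by (auto simp: PiE_def extensional_def)
    then show ?case unfolding s by auto
  next
    case (4 s)
    obtain x a where s: "s = (x, a)" by (cases s)
    have "x(v := a) \<in> Pi\<^sub>E (insert v (?R \<union> F)) X"
      using 4 PiE_fun_upd[of a X v x "?R \<union> F"] unfolding s by simp
    then show ?case using 4 unfolding s ins by (auto simp: upd)
  next
    case (5 x)
    then show ?case by simp
  qed
  also have "\<dots> = (\<Sum>x\<in>?A. \<Sum>a\<in>X v. Q R (x(v := a)) (x(v := a)))"
    by (simp add: sum.cartesian_product)
  also have "\<dots> = (\<Sum>x\<in>?A. Q ?R x x)"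
    using Suc.prems v by (simp add: Q_sum_diag)
  also have "\<dots> = 1"
    using Suc.prems Suc.hyps(2) v by (intro Suc.hyps(1)) auto
  finally show ?case .
qed

lemma K_kernel:
  assumes "R \<subseteq> random H" "F \<inter> R = {}"
  shows "K R F \<in> kernels X R F"
proof -
  have fin: "finite R" using assms finite_random finite_subset by blast
  have "(\<Sum>x | x \<in> Pi\<^sub>E (R \<union> F) X \<and> restrict x F = b. K R F x) = 1" if "b \<in> Pi\<^sub>E F X" for b
    unfolding sum_Q_diag[OF fin assms that, symmetric]
    by (rule sum.cong) (auto simp: K_def)
  then show ?thesis
    unfolding kernels_def by (auto simp: K_def nonneg)
qed

lemma Q_Union:
  assumes "finite \<D>" "\<And>D. D \<in> \<D> \<Longrightarrow> D \<subseteq> random H"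
    and "\<And>D D'. \<lbrakk>D \<in> \<D>; D' \<in> \<D>; D \<noteq> D'\<rbrakk> \<Longrightarrow> D \<inter> D' = {} \<and> bidir H \<inter> D \<times> D' = {}"
  shows "Q (\<Union>\<D>) x y = (\<Prod>D\<in>\<D>. Q D x y)"
  using assms
proof (induction rule: finite_induct)
  case empty
  then show ?case by (simp add: Q_empty)
next
  case (insert D \<D>)
  have ne: "D \<noteq> D'" if "D' \<in> \<D>" for D' using insert.hyps that by blast
  have "D \<inter> \<Union>\<D> = {}" "bidir H \<inter> D \<times> \<Union>\<D> = {}"
    using insert.prems(2)[of D] ne by blast+
  then have "Q (D \<union> \<Union>\<D>) x y = Q D x y * Q (\<Union>\<D>) x y"
    using insert.prems(1) by (intro indep) auto
  moreover have "Q (\<Union>\<D>) x y = (\<Prod>D\<in>\<D>. Q D x y)"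
    using insert.prems by (intro insert.IH) auto
  ultimately show ?case using insert.hyps by simp
qed

text \<open>The mixed graphs that occur in the recursion of the nested Markov property.\<close>

definition induced :: "'v mixed_graph \<Rightarrow> bool" where
  "induced H' \<longleftrightarrow> random H' \<subseteq> random H \<and> fixd H' \<subseteq> random H \<and> fixd H' \<inter> random H' = {} \<and>
     dir H' = {(u, v) \<in> dir H. v \<in> random H'} \<and> bidir H' = Restr (bidir H) (random H') \<and>
     pa H (random H') \<subseteq> random H' \<union> fixd H'"

section \<open>Districts, deletions and factorisations of induced graphs\<close>

lemma districts_partition:
  assumes "induced H'"
  shows "\<Union>(districts H') = random H'"
    and "\<lbrakk>D \<in> districts H'; D' \<in> districts H'; D \<noteq> D'\<rbrakk> \<Longrightarrow> D \<inter> D' = {} \<and> bidir H \<inter> D \<times> D' = {}"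
    and "D \<in> districts H' \<Longrightarrow> D \<subseteq> random H' \<and> D \<noteq> {}"
proof -
  let ?B = "Restr (bidir H') (random H')"
  have "sym ?B" using assms sym_bidir unfolding induced_def sym_def by auto
  then have s: "sym (?B\<^sup>*)" by (rule sym_rtrancl)
  show "\<Union>(districts H') = random H'" unfolding districts_def by blast
  show "D \<in> districts H' \<Longrightarrow> D \<subseteq> random H' \<and> D \<noteq> {}" unfolding districts_def by blast
  \<comment> \<open>Districts are classes of an equivalence relation. The empty walk at a common
    vertex gives disjointness, a walk along one edge gives the absence of bidirected edges between
    districts.\<close>
  have dj: "D = D'"
    if D: "D \<in> districts H'" "D' \<in> districts H'" and u: "u \<in> D" "u' \<in> D'" "(u, u') \<in> ?B\<^sup>*" for D D' u u'
  proof -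
    obtain v v' where v: "D = {u \<in> random H'. (v, u) \<in> ?B\<^sup>*}" "D' = {u \<in> random H'. (v', u) \<in> ?B\<^sup>*}"
      using D unfolding districts_def by blast
    have "(v, v') \<in> ?B\<^sup>*" using u s unfolding v by (auto dest: symD rtrancl_trans)
    moreover from this have "(v', v) \<in> ?B\<^sup>*" using s by (auto dest: symD)
    ultimately show ?thesis unfolding v by (auto dest: rtrancl_trans)
  qed
  assume D: "D \<in> districts H'" "D' \<in> districts H'" "D \<noteq> D'"
  have sub: "D \<subseteq> random H'" "D' \<subseteq> random H'" using D unfolding districts_def by blast+
  have "(u, u') \<in> ?B" if "(u, u') \<in> bidir H" "u \<in> D" "u' \<in> D'" for u u'
    using that sub assms unfolding induced_def by blast
  then have "bidir H \<inter> D \<times> D' = {}"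
    using dj[OF D(1,2)] D(3) by blast
  then show "D \<inter> D' = {} \<and> bidir H \<inter> D \<times> D' = {}"
    using dj[OF D(1,2)] D(3) by blast
qed

lemma pa_induced: "\<lbrakk>induced H'; D \<subseteq> random H'\<rbrakk> \<Longrightarrow> pa H' D = pa H D"
  unfolding induced_def pa_def by auto

lemma induced_district_graph:
  assumes "induced H'" "D \<subseteq> random H'"
  shows "induced (district_graph H' D)"
  using assms pa_induced[OF assms] dir_sub
  unfolding induced_def district_graph_def by (auto simp: pa_def)

text \<open>As \<open>v\<close> has no children, the only directed edges lost are those into
  \<open>v\<close>, so parents of the remaining random vertices are still present.\<close>

lemma induced_delete_vertex:
  assumes "induced H'" "ch H' v = {}" "v \<in> random H'"
  shows "induced (delete_vertex H' v)"
  using assms unfolding induced_def delete_vertex_def ch_def by (auto simp: pa_def)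

text \<open>\<open>H'\<close> keeps every directed edge of \<open>H\<close> into its random
  vertices, so \<open>v\<close> is no parent of them in \<open>H\<close> either and
  \<open>Q_sum_diag\<close> applies pointwise.\<close>

lemma sum_out_K:
  assumes "induced H'" "ch H' v = {}" "v \<in> random H'"
  shows "sum_out X H' v (K (random H') (fixd H')) = K (random H' - {v}) (fixd H')"
proof -
  have "v \<notin> pa H (random H')"
    using assms unfolding induced_def ch_def pa_def by auto
  moreover have "random H' \<subseteq> random H" using assms unfolding induced_def by blast
  moreover have "x(v := a) \<in> Pi\<^sub>E (random H' \<union> fixd H') X"
    if "x \<in> Pi\<^sub>E (random H' - {v} \<union> fixd H') X" "a \<in> X v" for x a
  proof -
    have "insert v (random H' - {v} \<union> fixd H') = random H' \<union> fixd H'" using assms by blast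
    then show ?thesis using that by (metis PiE_fun_upd)
  qed
  ultimately show ?thesis
    unfolding sum_out_def K_def using assms(3)
    by (intro restrict_ext) (simp add: Q_sum_diag)
qed

text \<open>No bidirected edge joins two districts, so \<open>Q_Union\<close> factorises
  \<open>Q\<close> with both arguments equal to \<open>x\<close>. Each factor sees only its district
  and the parents of it, which permits the restriction of \<open>x\<close>.\<close>

lemma K_districts:
  assumes "induced H'" "x \<in> Pi\<^sub>E (random H' \<union> fixd H') X"
  shows "K (random H') (fixd H') x =
    (\<Prod>D\<in>districts H'. K D (pa H' D - D) (restrict x (D \<union> pa H' D)))"
proof -
  have R: "random H' \<subseteq> random H" using assms unfolding induced_def by blast
  then have "finite (districts H')"
    unfolding districts_def using finite_random finite_subset by blast
  moreover have sub: "D \<subseteq> random H" if "D \<in> districts H'" for D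
    using districts_partition(3)[OF assms(1) that] R by blast
  ultimately have "Q (\<Union>(districts H')) x x = (\<Prod>D\<in>districts H'. Q D x x)"
    using districts_partition(2)[OF assms(1)] by (intro Q_Union) auto
  moreover have "Q D x x = K D (pa H' D - D) (restrict x (D \<union> pa H' D))" if "D \<in> districts H'" for D
  proof -
    let ?x = "restrict x (D \<union> pa H' D)"
    have D: "D \<subseteq> random H'" using districts_partition(3)[OF assms(1) that] by blast
    have p: "pa H' D = pa H D" using pa_induced[OF assms(1) D] .
    have "pa H D \<subseteq> pa H (random H')" using D unfolding pa_def by blast
    then have "D \<union> pa H D \<subseteq> random H' \<union> fixd H'"
      using D assms(1) unfolding induced_def by blast
    then have "?x \<in> Pi\<^sub>E (D \<union> pa H D) X"
      using assms(2) unfolding p by auto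
    then have "K D (pa H' D - D) ?x = Q D ?x ?x"
      unfolding K_def p by simp
    also have "\<dots> = Q D x ?x" using sub[OF that] by (intro cong_out) auto
    also have "\<dots> = Q D x x" using sub[OF that] by (intro cong_in) (auto simp: p)
    finally show ?thesis by simp
  qed
  ultimately show ?thesis
    using assms districts_partition(1)[OF assms(1)] by (simp add: K_def)
qed

text \<open>Induction along the lexicographic measure of the recursion: district factors and
  marginals are again diagonal kernels of induced graphs.\<close>

lemma nested_markov_induced:
  assumes "induced H'"
  shows "nested_markov X H' (K (random H') (fixd H'))"
  using assms
proof (induction H' rule: wf_induct[OF wf_measures[of "[\<lambda>H'. card (random H'), \<lambda>H'. card (fixd H')]"]])
  case (1 H')
  note ind = 1(2)
  have R: "random H' \<subseteq> random H" "fixd H' \<inter> random H' = {}" "fixd H' \<subseteq> random H" "pa H (random H') \<subseteq> random H' \<union> fixd H'"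
    using ind unfolding induced_def by blast+
  then have fin: "finite (random H')" "finite (fixd H')" using finite_random finite_subset by blast+
  have IH: "nested_markov X H'' (K (random H'') (fixd H''))"
    if "induced H''" "card (random H'') < card (random H') \<or>
      card (random H'') = card (random H') \<and> card (fixd H'') < card (fixd H')" for H''
    using 1(1) that by auto
  show ?case
  proof (cases "random H' = {}")
    case True
    then show ?thesis using R K_kernel by (intro no_random) auto
  next
    case False
    show ?thesis
    proof (rule nested)
      show "K (random H') (fixd H') \<in> kernels X (random H') (fixd H')"
        using R by (intro K_kernel) auto
      show "\<forall>D\<in>districts H'. K D (pa H' D - D) \<in> kernels X D (pa H' D - D)"
        using R districts_partition(3)[OF ind] by (intro ballI K_kernel) blast+
      show "\<forall>x\<in>Pi\<^sub>E (random H' \<union> fixd H') X. K (random H') (fixd H') x =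
          (\<Prod>D\<in>districts H'. K D (pa H' D - D) (restrict x (D \<union> pa H' D)))"
        using K_districts[OF ind] by blast
      show "\<forall>v\<in>random H'. ch H' v = {} \<longrightarrow>
          nested_markov X (delete_vertex H' v) (sum_out X H' v (K (random H') (fixd H')))"
      proof (intro ballI impI)
        fix v assume v: "v \<in> random H'" "ch H' v = {}"
        have "card (random H' - {v}) < card (random H')" using v(1) fin(1) by (rule card_Diff1_less[rotated])
        then have "nested_markov X (delete_vertex H' v) (K (random (delete_vertex H' v)) (fixd (delete_vertex H' v)))"
          using induced_delete_vertex[OF ind v(2,1)] by (intro IH) (auto simp: delete_vertex_def)
        then show "nested_markov X (delete_vertex H' v) (sum_out X H' v (K (random H') (fixd H')))"
          using sum_out_K[OF ind v(2,1)] by (simp add: delete_vertex_def)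
      qed
      show "card (districts H') \<ge> 2 \<or> fixd H' - pa H' (random H') \<noteq> {} \<longrightarrow>
          (\<forall>D\<in>districts H'. nested_markov X (district_graph H' D) (K D (pa H' D - D)))"
      proof (intro impI ballI)
        fix D assume c: "card (districts H') \<ge> 2 \<or> fixd H' - pa H' (random H') \<noteq> {}"
          and D: "D \<in> districts H'"
        have sub: "D \<subseteq> random H'" using D districts_partition(3)[OF ind] by blast
        \<comment> \<open>If \<open>D\<close> is all of \<open>random H'\<close>, there is only one
          district, so the condition \<open>c\<close> must provide a fixed vertex without children
          among the random ones. The district graph drops it, and the second component of the
          measure decreases.\<close>
        have "card D < card (random H') \<or>
          card D = card (random H') \<and> card (pa H' D - D) < card (fixd H')"
        proof (cases "D = random H'")
          case True
          have "D' = D" if "D' \<in> districts H'" for D'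
            using districts_partition(2)[OF ind that D] districts_partition(3)[OF ind that] True by blast
          then have "districts H' \<subseteq> {D}" by blast
          then have "card (districts H') \<le> 1"
            using card_mono[of "{D}" "districts H'"] by simp
          then have "fixd H' - pa H' (random H') \<noteq> {}" using c by linarith
          moreover have "pa H' (random H') - random H' \<subseteq> fixd H'"
            using R(4) pa_induced[OF ind subset_refl] by auto
          ultimately have "pa H' D - D \<subset> fixd H'" unfolding True by blast
          then show ?thesis using True fin by (simp add: psubset_card_mono)
        next
          case False
          then show ?thesis using sub fin by (auto intro: psubset_card_mono)
        qed
        then have "nested_markov X (district_graph H' D)
            (K (random (district_graph H' D)) (fixd (district_graph H' D)))"
          using induced_district_graph[OF ind sub] by (intro IH) (auto simp: district_graph_def)
        then show "nested_markov X (district_graph H' D) (K D (pa H' D - D))"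
          by (simp add: district_graph_def)
      qed
    qed
  qed
qed

lemma nested_markov_diagonal:
  "nested_markov X H (\<lambda>x\<in>Pi\<^sub>E (random H) X. Q (random H) x x)"
    and diagonal_distribution: "(\<lambda>x\<in>Pi\<^sub>E (random H) X. Q (random H) x x) \<in> distributions X (random H)"
proof -
  have "induced H"
    unfolding induced_def using dir_sub bidir_sub fixd_empty by (auto simp: pa_def)
  from nested_markov_induced[OF this] show "nested_markov X H (\<lambda>x\<in>Pi\<^sub>E (random H) X. Q (random H) x x)"
    by (simp add: K_def fixd_empty)
  show "(\<lambda>x\<in>Pi\<^sub>E (random H) X. Q (random H) x x) \<in> distributions X (random H)"
    using K_kernel[of "random H" "{}"] by (simp add: K_def)
qed

end

section \<open>Treks in the split graph\<close>

text \<open>Members of \<open>C\<close> have no parents, so a vertex that reaches \<open>C\<close>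
  lies in \<open>C\<close> and is parentless, unlike a collider. An open path thus has no collider:
  it climbs to position \<open>m\<close> and descends from there.\<close>

lemma not_blocked_trek:
  assumes "\<not> blocked E C p" "is_path E p"
    and roots: "\<And>c u. c \<in> C \<Longrightarrow> (u, c) \<notin> E"
  obtains m where "m < length p" "\<And>i. i < m \<Longrightarrow> (p ! Suc i, p ! i) \<in> E"
    "\<And>i. \<lbrakk>m \<le> i; Suc i < length p\<rbrakk> \<Longrightarrow> (p ! i, p ! Suc i) \<in> E"
    "\<And>i. \<lbrakk>0 < i; Suc i < length p\<rbrakk> \<Longrightarrow> p ! i \<notin> C"
proof -
  have nc: "\<not> collider E p i \<and> p ! i \<notin> C" if i: "0 < i" "Suc i < length p" for i
  proof (cases "collider E p i")
    case True
    then obtain c where c: "c \<in> C" "(p ! i, c) \<in> E\<^sup>*"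
      using assms(1) i unfolding blocked_def by metis
    then have "p ! i = c" using roots by (metis rtranclE)
    then show ?thesis using True c(1) roots unfolding collider_def by blast
  next
    case False
    then show ?thesis using assms(1) i unfolding blocked_def by metis
  qed
  \<comment> \<open>The top is the first position from which the path does not climb; the last
    position qualifies vacuously.\<close>
  let ?P = "\<lambda>k. Suc k < length p \<longrightarrow> (p ! Suc k, p ! k) \<notin> E"
  define m where "m = (LEAST k. ?P k)"
  have len: "0 < length p" using assms(2) unfolding is_path_def by simp
  have P: "?P (length p - 1)" using len by simp
  have "m \<le> length p - 1" unfolding m_def by (rule Least_le) (rule P)
  then have 1: "m < length p" using len by linarith
  have 2: "(p ! Suc i, p ! i) \<in> E" if "i < m" for i
    using not_less_Least[of i ?P] that unfolding m_def by blast
  have 3: "(p ! i, p ! Suc i) \<in> E" if "m \<le> i" "Suc i < length p" for i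
    using that
  proof (induction i rule: dec_induct)
    case base
    have "?P m" unfolding m_def by (rule LeastI[of ?P]) (rule P)
    then show ?case using base assms(2) unfolding is_path_def by blast
  next
    case (step i)
    then have "(p ! i, p ! Suc i) \<in> E" by simp
    then have "(p ! Suc (Suc i), p ! Suc i) \<notin> E"
      using nc[of "Suc i"] step.prems unfolding collider_def by simp
    then show ?case using step.prems assms(2) unfolding is_path_def by blast
  qed
  show thesis using that[OF 1 2 3] nc by blast
qed

section \<open>Latent paths: extraction from indexed walks, and their images under
  unsplitting\<close>

lemma directed_latent_path:
  assumes "i < j" "\<And>k. \<lbrakk>i \<le> k; k < j\<rbrakk> \<Longrightarrow> (f k, f (Suc k)) \<in> edges G"
    and "\<And>k. \<lbrakk>i < k; k < j\<rbrakk> \<Longrightarrow> f k \<in> lat G"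
  shows "(f i, f j) \<in> latent_paths G"
proof -
  have "(f i, f k) \<in> (edges G \<inter> UNIV \<times> lat G)\<^sup>*" if "i \<le> k" "k < j" for k
    using that
  proof (induction k rule: dec_induct)
    case (step k)
    then have "(f k, f (Suc k)) \<in> edges G \<inter> UNIV \<times> lat G"
      using assms(2)[of k] assms(3)[of "Suc k"] by simp
    then show ?case using step by (simp add: rtrancl_into_rtrancl)
  qed simp
  from this[of "j - 1"] have "(f i, f (j - 1)) \<in> (edges G \<inter> UNIV \<times> lat G)\<^sup>*"
    using assms(1) by simp
  moreover have "(f (j - 1), f j) \<in> edges G"
    using assms(1) assms(2)[of "j - 1"] by simp
  ultimately show ?thesis unfolding latent_paths_def by blast
qed

lemma backward_latent_path:
  assumes "i < j" "\<And>k. \<lbrakk>i \<le> k; k < j\<rbrakk> \<Longrightarrow> (f (Suc k), f k) \<in> edges G"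
    and "\<And>k. \<lbrakk>i < k; k < j\<rbrakk> \<Longrightarrow> f k \<in> lat G"
  shows "(f j, f i) \<in> latent_paths G"
proof -
  \<comment> \<open>The index substitution reverses the walk and exchanges its ends.\<close>
  have "((\<lambda>k. f (i + j - k)) i, (\<lambda>k. f (i + j - k)) j) \<in> latent_paths G"
  proof (rule directed_latent_path[OF assms(1)])
    fix k assume "i \<le> k" "k < j"
    then have "(f (Suc (i + j - Suc k)), f (i + j - Suc k)) \<in> edges G"
      by (intro assms(2)) auto
    moreover have "Suc (i + j - Suc k) = i + j - k" using \<open>k < j\<close> by simp
    ultimately show "(f (i + j - k), f (i + j - Suc k)) \<in> edges G" by simp
  qed (use assms(3) in auto)
  then show ?thesis by simp
qed

fun base :: "'v split_vertex \<Rightarrow> 'v" where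
  "base (Orig v) = v" | "base (Sharp v) = v"

text \<open>\<open>base\<close> merges the two copies of a split vertex and maps edges to edges and
  latent vertices to latent vertices.\<close>

lemma latent_paths_base:
  assumes "(a, b) \<in> latent_paths (VVSplit G)"
  shows "(base a, base b) \<in> latent_paths G"
proof -
  have e: "(base a, base b) \<in> edges G" if "(a, b) \<in> edges (VVSplit G)" for a b
    using that by (auto simp: VVSplit_def)
  have l: "base b \<in> lat G" if "b \<in> lat (VVSplit G)" for b
    using that by (auto simp: VVSplit_def)
  obtain c where c: "(a, c) \<in> (edges (VVSplit G) \<inter> UNIV \<times> lat (VVSplit G))\<^sup>*" "(c, b) \<in> edges (VVSplit G)"
    using assms unfolding latent_paths_def by blast
  from c(1) have "(base a, base c) \<in> (edges G \<inter> UNIV \<times> lat G)\<^sup>*"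
    by (induction rule: rtrancl_induct) (auto dest: e l intro: rtrancl_into_rtrancl)
  then show ?thesis using e[OF c(2)] unfolding latent_paths_def by blast
qed

lemma latent_paths_trancl: "(a, b) \<in> latent_paths G \<Longrightarrow> (a, b) \<in> (edges G)\<^sup>+"
proof -
  assume "(a, b) \<in> latent_paths G"
  then obtain c where "(a, c) \<in> (edges G \<inter> UNIV \<times> lat G)\<^sup>*" "(c, b) \<in> edges G"
    unfolding latent_paths_def by blast
  moreover have "(edges G \<inter> UNIV \<times> lat G)\<^sup>* \<subseteq> (edges G)\<^sup>*" by (rule rtrancl_mono) blast
  ultimately show ?thesis by (meson rtrancl_into_trancl1 subsetD)
qed

section \<open>Inputs of the split graph and the three d-separations\<close>

definition roots :: "('v, 'a) causal_dag \<Rightarrow> 'v set" where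
  "roots G = {v \<in> obs G. \<forall>u. (u, v) \<notin> edges G}"

text \<open>Exactly the parentless observed vertices after the splitting: a root has no incoming
  edge, so it is never split and acts on its children directly.\<close>

abbreviation inputs :: "('v, 'a) causal_dag \<Rightarrow> 'v split_vertex set" where
  "inputs G \<equiv> Orig ` roots G \<union> Sharp ` split_vertices G"

lemma inputs_parentless: "i \<in> inputs G \<Longrightarrow> (u, i) \<notin> edges (VVSplit G)"
  by (auto simp: VVSplit_def roots_def)

text \<open>An observed vertex with a parent and a child is split, and its outgoing edges then start
  at the sharp copy.\<close>

lemma nonroot_childless: "v \<in> obs G - roots G \<Longrightarrow> (Orig v, u) \<notin> edges (VVSplit G)"
  by (auto simp: VVSplit_def roots_def split_vertices_def)

lemma internal_latent:
  assumes "causal_dag G" "(u, a) \<in> edges (VVSplit G)" "(a, w) \<in> edges (VVSplit G)"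
  shows "a \<in> lat (VVSplit G)"
proof -
  obtain v where v: "a = Orig v" using assms(2) by (cases a) (auto simp: VVSplit_def)
  have "(base u, v) \<in> edges G" using assms(2) unfolding v by (auto simp: VVSplit_def)
  moreover from this have "v \<in> obs G \<union> lat G" using assms(1) unfolding causal_dag_def by blast
  ultimately show ?thesis
    using assms(3) nonroot_childless[of v G w] unfolding v by (auto simp: VVSplit_def roots_def)
qed

text \<open>An open path would be a trek. Its parentless head must be the top, so it would end with
  an edge into its last vertex, which is parentless too.\<close>

lemma d_separated_inputs:
  assumes "A \<subseteq> inputs G" "B \<subseteq> inputs G" "A \<inter> B = {}"
  shows "d_separated (edges (VVSplit G)) A B {}"
  unfolding d_separated_def
proof (intro allI impI, rule ccontr)
  fix p assume p: "is_path (edges (VVSplit G)) p \<and> hd p \<in> A \<and> last p \<in> B"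
    and nb: "\<not> blocked (edges (VVSplit G)) {} p"
  obtain m where m: "m < length p" "\<And>i. i < m \<Longrightarrow> (p ! Suc i, p ! i) \<in> edges (VVSplit G)"
    "\<And>i. \<lbrakk>m \<le> i; Suc i < length p\<rbrakk> \<Longrightarrow> (p ! i, p ! Suc i) \<in> edges (VVSplit G)"
    using not_blocked_trek[OF nb] p by (metis empty_iff)
  have ne: "p \<noteq> []" using p unfolding is_path_def by blast
  have h: "p ! 0 \<in> inputs G" "p ! (length p - 1) \<in> inputs G"
    using p assms(1,2) by (auto simp: hd_conv_nth[OF ne] last_conv_nth[OF ne])
  have "m = 0" using m(2)[of 0] inputs_parentless[OF h(1)] by (cases m) auto
  have "hd p \<noteq> last p" using p assms(3) by auto
  then have "length p \<ge> 2" using ne by (cases p) (auto simp: Suc_le_eq)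
  moreover from this have "Suc (length p - 2) = length p - 1" by simp
  ultimately have "(p ! (length p - 2), p ! (length p - 1)) \<in> edges (VVSplit G)"
    using m(3)[of "length p - 2"] \<open>m = 0\<close> by force
  then show False using inputs_parentless[OF h(2)] by blast
qed

text \<open>An open path would end in a parentless input, which must be the top of the trek. This
  makes it a directed path from that input to \<open>S\<close> with latent interior, contrary to the
  hypothesis.\<close>

lemma d_separated_nonparents:
  assumes "causal_dag G" "S \<subseteq> obs G - roots G" "C \<subseteq> inputs G"
    and "\<And>i v. \<lbrakk>i \<in> inputs G - C; v \<in> S\<rbrakk> \<Longrightarrow> (base i, v) \<notin> latent_paths G"
  shows "d_separated (edges (VVSplit G)) (Orig ` S) (inputs G - C) C"
  unfolding d_separated_def
proof (intro allI impI, rule ccontr)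
  let ?E = "edges (VVSplit G)"
  fix p assume p: "is_path ?E p \<and> hd p \<in> Orig ` S \<and> last p \<in> inputs G - C" and nb: "\<not> blocked ?E C p"
  have r: "(u, c) \<notin> ?E" if "c \<in> C" for u c by (rule inputs_parentless[OF subsetD[OF assms(3) that]])
  obtain m where m: "m < length p" "\<And>i. i < m \<Longrightarrow> (p ! Suc i, p ! i) \<in> ?E"
    "\<And>i. \<lbrakk>m \<le> i; Suc i < length p\<rbrakk> \<Longrightarrow> (p ! i, p ! Suc i) \<in> ?E"
    using not_blocked_trek[OF nb _ r] p by metis
  have ne: "p \<noteq> []" using p unfolding is_path_def by blast
  let ?n = "length p - 1"
  obtain v where v: "v \<in> S" "p ! 0 = Orig v" using p ne by (metis hd_conv_nth imageE)
  have l: "p ! ?n \<in> inputs G - C" using p ne by (simp add: last_conv_nth)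
  have "p ! 0 \<noteq> p ! ?n" using v l assms(2) by auto
  then have n: "0 < ?n" by (cases "?n = 0") auto
  have "m = ?n"
  proof (rule ccontr)
    assume "m \<noteq> ?n"
    moreover have "Suc (?n - 1) = ?n" using n by simp
    ultimately have "(p ! (?n - 1), p ! ?n) \<in> ?E" using m(1) m(3)[of "?n - 1"] by force
    then show False using inputs_parentless[of "p ! ?n" G] l by simp
  qed
  have "(p ! ?n, p ! 0) \<in> latent_paths (VVSplit G)"
  proof (rule backward_latent_path[OF n])
    show "(p ! Suc k, p ! k) \<in> ?E" if "k < ?n" for k using m(2) that \<open>m = ?n\<close> by blast
    show "p ! k \<in> lat (VVSplit G)" if "0 < k" "k < ?n" for k
      using m(2)[of "k - 1"] m(2)[of k] that \<open>m = ?n\<close>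
      by (intro internal_latent[OF assms(1), of "p ! Suc k" _ "p ! (k - 1)"]) simp_all
  qed
  then have "(base (p ! ?n), v) \<in> latent_paths G" using latent_paths_base v(2) by fastforce
  then show False using assms(4)[OF l v(1)] by blast
qed

text \<open>Both ends are nonroots and hence childless, so an open trek climbs first and descends
  last. Its top has a child and is no input, hence is latent, with latent paths to both
  ends.\<close>

lemma d_separated_districts:
  assumes "causal_dag G" "S \<subseteq> obs G - roots G" "T \<subseteq> obs G - roots G" "S \<inter> T = {}"
    and "\<And>s t w. \<lbrakk>s \<in> S; t \<in> T; w \<in> lat G; (w, s) \<in> latent_paths G\<rbrakk> \<Longrightarrow> (w, t) \<notin> latent_paths G"
  shows "d_separated (edges (VVSplit G)) (Orig ` S) (Orig ` T) (inputs G)"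
  unfolding d_separated_def
proof (intro allI impI, rule ccontr)
  let ?E = "edges (VVSplit G)"
  fix p assume p: "is_path ?E p \<and> hd p \<in> Orig ` S \<and> last p \<in> Orig ` T" and nb: "\<not> blocked ?E (inputs G) p"
  obtain m where m: "m < length p" "\<And>i. i < m \<Longrightarrow> (p ! Suc i, p ! i) \<in> ?E"
    "\<And>i. \<lbrakk>m \<le> i; Suc i < length p\<rbrakk> \<Longrightarrow> (p ! i, p ! Suc i) \<in> ?E"
    "\<And>i. \<lbrakk>0 < i; Suc i < length p\<rbrakk> \<Longrightarrow> p ! i \<notin> inputs G"
    using not_blocked_trek[OF nb _ inputs_parentless] p by metis
  have ne: "p \<noteq> []" using p unfolding is_path_def by blast
  let ?n = "length p - 1"
  obtain s where s: "s \<in> S" "p ! 0 = Orig s" using p ne by (metis hd_conv_nth imageE)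
  obtain t where t: "t \<in> T" "p ! ?n = Orig t" using p ne by (metis last_conv_nth imageE)
  have cs: "(p ! 0, u) \<notin> ?E" for u using s nonroot_childless assms(2) by (metis subsetD)
  have ct: "(p ! ?n, u) \<notin> ?E" for u using t nonroot_childless assms(3) by (metis subsetD)
  have "p ! 0 \<noteq> p ! ?n" using s t assms(4) by auto
  then have n: "0 < ?n" by (cases "?n = 0") auto
  have m0: "0 < m" using cs[of "p ! Suc 0"] m(3)[of 0] n by (cases "m = 0") auto
  have mn: "m < ?n"
  proof (rule ccontr)
    assume "\<not> m < ?n"
    moreover have "Suc (?n - 1) = ?n" using n by simp
    ultimately have "(p ! ?n, p ! (?n - 1)) \<in> ?E" using m(1) m(2)[of "?n - 1"] by force
    then show False using ct by blast
  qed
  have top: "p ! m \<in> lat (VVSplit G)"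
  proof -
    have e: "(p ! m, p ! Suc m) \<in> ?E" using m(3)[of m] mn by simp
    have ni: "p ! m \<notin> inputs G" using m(4)[of m] m0 mn by simp
    show ?thesis
    proof (cases "p ! m")
      case (Orig v)
      have "v \<in> obs G \<union> lat G"
        using e assms(1) unfolding Orig causal_dag_def by (auto simp: VVSplit_def)
      moreover have "v \<notin> obs G" using e ni nonroot_childless[of v G] unfolding Orig by blast
      ultimately show ?thesis unfolding Orig by (simp add: VVSplit_def)
    next
      case (Sharp v)
      then show ?thesis using e ni by (auto simp: VVSplit_def)
    qed
  qed
  have "(p ! m, p ! 0) \<in> latent_paths (VVSplit G)"
  proof (rule backward_latent_path[OF m0])
    show "p ! k \<in> lat (VVSplit G)" if "0 < k" "k < m" for k
      using m(2)[of "k - 1"] m(2)[of k] that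
      by (intro internal_latent[OF assms(1), of "p ! Suc k" _ "p ! (k - 1)"]) simp_all
  qed (use m(2) in blast)
  moreover have "(p ! m, p ! ?n) \<in> latent_paths (VVSplit G)"
  proof (rule directed_latent_path[OF mn])
    show "p ! k \<in> lat (VVSplit G)" if "m < k" "k < ?n" for k
      using m(3)[of "k - 1"] m(3)[of k] that
      by (intro internal_latent[OF assms(1), of "p ! (k - 1)" _ "p ! Suc k"]) simp_all
  qed (use m(3) in auto)
  ultimately have "(base (p ! m), s) \<in> latent_paths G" "(base (p ! m), t) \<in> latent_paths G"
    using latent_paths_base s(2) t(2) by fastforce+
  moreover have "base (p ! m) \<in> lat G" using top by (auto simp: VVSplit_def)
  ultimately show False using assms(5) s(1) t(1) by blast
qed

section \<open>Marginals\<close>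

lemma restrict_eq_iff: "restrict x S = restrict y S \<longleftrightarrow> (\<forall>v\<in>S. x v = y v)"
  by (metis restrict_apply' restrict_ext)

lemma marginal_cong:
  assumes "\<And>v. v \<in> S \<Longrightarrow> x v = x' v"
  shows "marginal X V p S x = marginal X V p S x'"
proof -
  have "restrict x S = restrict x' S" using assms by (simp add: restrict_eq_iff)
  then show ?thesis unfolding marginal_def by simp
qed

lemma marginal_nonneg:
  assumes "\<And>y. y \<in> Pi\<^sub>E V X \<Longrightarrow> 0 \<le> p y"
  shows "0 \<le> marginal X V p S x"
  unfolding marginal_def using assms by (intro sum_nonneg) auto

lemma marginal_antimono:
  assumes "finite (Pi\<^sub>E V X)" "\<And>y. y \<in> Pi\<^sub>E V X \<Longrightarrow> 0 \<le> p y" "S \<subseteq> T"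
  shows "marginal X V p T x \<le> marginal X V p S x"
  unfolding marginal_def using assms by (intro sum_mono2) (auto simp: restrict_eq_iff)

lemma sum_marginal:
  assumes "finite (Pi\<^sub>E V X)" "finite (X v)" "v \<in> V" "v \<notin> S"
  shows "(\<Sum>a\<in>X v. marginal X V p (insert v S) (x(v := a))) = marginal X V p S x"
proof -
  let ?A = "{y \<in> Pi\<^sub>E V X. restrict y S = restrict x S}"
  have "marginal X V p (insert v S) (x(v := a)) = sum p {y \<in> ?A. y v = a}" for a
    unfolding marginal_def using assms(4)
    by (intro arg_cong[where f = "sum p"]) (auto simp: restrict_eq_iff fun_upd_def split: if_splits)
  moreover have "(\<Sum>a\<in>X v. sum p {y \<in> ?A. y v = a}) = sum p ?A"
    using assms by (intro sum.group) auto
  ultimately show ?thesis unfolding marginal_def by simp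
qed

lemma marginal_full:
  assumes "x \<in> Pi\<^sub>E V X"
  shows "marginal X V p V x = p x"
proof -
  have "{y. y \<in> Pi\<^sub>E V X \<and> restrict y V = restrict x V} = {x}"
    using assms by auto
  then show ?thesis unfolding marginal_def by simp
qed

section \<open>The kernel of a split Markov model\<close>

locale split_markov =
  fixes G :: "('v, 'a) causal_dag" and q :: "('v split_vertex \<Rightarrow> 'a) \<Rightarrow> real"
  assumes dag: "causal_dag G"
    and q: "q \<in> markov_kernels (VVSplit G) (Sharp ` split_vertices G)"
begin

abbreviation X where "X \<equiv> alph (VVSplit G)"
abbreviation V where "V \<equiv> obs (VVSplit G)"
abbreviation sharps where "sharps \<equiv> Sharp ` split_vertices G"

text \<open>The mass of each single joint value of the sharp vertices under independent uniform
  inputs.\<close>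

definition c :: real where "c = (\<Prod>s\<in>sharps. 1 / real (card (X s)))"

definition joint :: "('v split_vertex \<Rightarrow> 'a) \<Rightarrow> real" where
  "joint = (\<lambda>x\<in>Pi\<^sub>E V X. c * q x)"

abbreviation M where "M \<equiv> marginal X V joint"

text \<open>Values of probability zero are replaced, so that conditioning on the inputs is always possible.\<close>

definition clip :: "'v split_vertex \<Rightarrow> 'a \<Rightarrow> 'a" where
  "clip i a = (if a \<in> X i \<and> M {i} (\<lambda>_. a) > 0 then a else SOME b. b \<in> X i \<and> M {i} (\<lambda>_. b) > 0)"

text \<open>Inputs are read from \<open>y\<close>, all other vertices from \<open>x\<close>.
  Clipping and the default choice yield, for arbitrary \<open>x\<close> and \<open>y\<close>, a
  joint value at which the inputs have positive probability, as \<open>cond_indep\<close>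
  demands.\<close>

definition assign :: "('v \<Rightarrow> 'a) \<Rightarrow> ('v \<Rightarrow> 'a) \<Rightarrow> 'v split_vertex \<Rightarrow> 'a" where
  "assign x y = (\<lambda>i\<in>V. if i \<in> inputs G then clip i (y (base i))
     else if x (base i) \<in> X i then x (base i) else SOME b. b \<in> X i)"

text \<open>A root counts twice: as an output with its own marginal in the product, and as an input
  in the condition. The quotient is the conditional probability of the nonroots of \<open>S\<close>
  given all inputs. The product reads \<open>x\<close> unclipped, so impossible root values keep
  weight zero.\<close>

definition Q :: "'v set \<Rightarrow> ('v \<Rightarrow> 'a) \<Rightarrow> ('v \<Rightarrow> 'a) \<Rightarrow> real" where
  "Q S x y = (\<Prod>v\<in>S \<inter> roots G. M {Orig v} (x \<circ> base)) *
     (M (Orig ` (S - roots G) \<union> inputs G) (assign x y) / M (inputs G) (assign x y))"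

section \<open>The joint distribution with uniform sharp vertices\<close>

lemma split_obs: "split_vertices G \<subseteq> obs G" and roots_obs: "roots G \<subseteq> obs G"
  by (auto simp: split_vertices_def roots_def)

lemma V_eq: "V = Orig ` obs G \<union> sharps"
  by (simp add: VVSplit_def)

lemma inputs_V: "inputs G \<subseteq> V"
  unfolding V_eq using roots_obs by auto

lemma X_Orig [simp]: "X (Orig v) = alph G v"
  by (simp add: VVSplit_def)

lemma finite_obs: "finite (obs G)"
  using dag unfolding causal_dag_def by blast

lemma finite_sharps: "finite sharps"
  using finite_subset[OF split_obs finite_obs] by simp

lemma finite_V: "finite V"
  unfolding V_eq using finite_obs finite_sharps by simp

lemma alph_X: "i \<in> V \<Longrightarrow> finite (X i) \<and> X i \<noteq> {}"
  using causal_dag_VVSplit[OF dag] unfolding causal_dag_def by blast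

lemma finite_PiE_V: "finite (Pi\<^sub>E V X)"
  using finite_V alph_X by (intro finite_PiE) auto

lemma c_pos: "0 < c"
  unfolding c_def
proof (rule prod_pos)
  fix s assume "s \<in> sharps"
  then have "s \<in> V" unfolding V_eq by blast
  then show "0 < 1 / real (card (X s))" using alph_X by (simp add: card_gt_0_iff)
qed

lemma q_kernel: "q \<in> kernels X (V - sharps) sharps"
  using q unfolding markov_kernels_def by blast

lemma sharps_V: "V - sharps \<union> sharps = V"
  unfolding V_eq by blast

lemma q_nonneg: "x \<in> Pi\<^sub>E V X \<Longrightarrow> 0 \<le> q x"
  using q_kernel unfolding kernels_def sharps_V by (auto simp: PiE_iff)

lemma joint_model: "joint \<in> markov_model (VVSplit G)"
  using q unfolding markov_kernels_def joint_def c_def by blast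

lemma joint_nonneg: "x \<in> Pi\<^sub>E V X \<Longrightarrow> 0 \<le> joint x"
  using q_nonneg c_pos unfolding joint_def by simp

lemma M_empty: "M {} x = 1"
proof -
  have "restrict x {} \<in> Pi\<^sub>E {} X" by (simp add: restrict_def)
  then show ?thesis
    using joint_model unfolding markov_model_def kernels_def marginal_def Un_empty_right by blast
qed

lemmas M_nonneg = marginal_nonneg[of V X joint, OF joint_nonneg]
lemmas M_antimono = marginal_antimono[of V X joint, OF finite_PiE_V joint_nonneg]

lemma M_indep:
  assumes "A \<subseteq> V" "B \<subseteq> V" "C \<subseteq> V" "A \<inter> B = {}" "A \<inter> C = {}" "B \<inter> C = {}"
    and "d_separated (edges (VVSplit G)) A B C" "z \<in> Pi\<^sub>E V X" "0 < M C z"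
  shows "M (A \<union> B \<union> C) z / M C z = (M (A \<union> C) z / M C z) * (M (B \<union> C) z / M C z)"
  using joint_model assms unfolding markov_model_def cond_indep_def by blast

lemma M_sharps:
  assumes "z \<in> Pi\<^sub>E V X"
  shows "M sharps z = c"
proof -
  have "restrict z sharps \<in> Pi\<^sub>E sharps X"
    using assms unfolding V_eq by auto
  then have "(\<Sum>x | x \<in> Pi\<^sub>E V X \<and> restrict x sharps = restrict z sharps. q x) = 1"
    using q_kernel unfolding kernels_def sharps_V by blast
  then have "c * (\<Sum>x | x \<in> Pi\<^sub>E V X \<and> restrict x sharps = restrict z sharps. q x) = c"
    by simp
  then show ?thesis
    unfolding marginal_def joint_def by (simp add: sum_distrib_left)
qed

lemma sum_M_single:
  assumes "i \<in> V"
  shows "(\<Sum>a\<in>X i. M {i} (x(i := a))) = 1"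
  using sum_marginal[of V X i "{}" joint x] assms finite_PiE_V alph_X M_empty by simp

text \<open>The marginal of a single vertex sums to one, so some value has positive probability and
  the choice in \<open>clip\<close> succeeds.\<close>

lemma clip:
  assumes "i \<in> V"
  shows "clip i a \<in> X i" "0 < M {i} (\<lambda>_. clip i a)"
proof -
  have "\<exists>b. b \<in> X i \<and> 0 < M {i} (\<lambda>_. b)"
  proof (rule ccontr)
    assume n: "\<nexists>b. b \<in> X i \<and> 0 < M {i} (\<lambda>_. b)"
    have "M {i} ((\<lambda>_. undefined)(i := a)) \<le> 0" if "a \<in> X i" for a
      using n that marginal_cong[of "{i}" "(\<lambda>_. undefined)(i := a)" "\<lambda>_. a"] by force
    then have "(\<Sum>a\<in>X i. M {i} ((\<lambda>_. undefined)(i := a))) \<le> 0" by (rule sum_nonpos)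
    then show False using sum_M_single[OF assms] by simp
  qed
  from someI_ex[OF this] show "clip i a \<in> X i" "0 < M {i} (\<lambda>_. clip i a)"
    unfolding clip_def by auto
qed

lemma assign_PiE: "assign x y \<in> Pi\<^sub>E V X"
proof -
  have "(SOME b. b \<in> X i) \<in> X i" if "i \<in> V" for i
    using alph_X[OF that] some_in_eq by blast
  then show ?thesis unfolding assign_def using clip(1) inputs_V by auto
qed

text \<open>Disjoint sets of inputs are d-separated by the empty set, so roots split off one at a
  time from the sharp vertices, whose joint mass is \<open>c\<close>.\<close>

lemma M_inputs:
  assumes "z \<in> Pi\<^sub>E V X"
  shows "M (inputs G) z = (\<Prod>v\<in>roots G. M {Orig v} z) * c"
proof -
  have "M (Orig ` A \<union> sharps) z = (\<Prod>v\<in>A. M {Orig v} z) * c" if "finite A" "A \<subseteq> roots G" for A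
    using that
  proof (induction A rule: finite_induct)
    case empty
    then show ?case using M_sharps[OF assms] by simp
  next
    case (insert v A)
    have sub: "{Orig v} \<subseteq> inputs G" "Orig ` A \<union> sharps \<subseteq> inputs G" "{Orig v} \<inter> (Orig ` A \<union> sharps) = {}"
      using insert.prems insert.hyps by auto
    have "M ({Orig v} \<union> (Orig ` A \<union> sharps) \<union> {}) z / M {} z =
        M ({Orig v} \<union> {}) z / M {} z * (M (Orig ` A \<union> sharps \<union> {}) z / M {} z)"
      by (rule M_indep[OF subset_trans[OF sub(1) inputs_V] subset_trans[OF sub(2) inputs_V] empty_subsetI
            sub(3) Int_empty_right Int_empty_right d_separated_inputs[OF sub] assms]) (simp add: M_empty)
    then have "M ({Orig v} \<union> (Orig ` A \<union> sharps)) z = M {Orig v} z * M (Orig ` A \<union> sharps) z"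
      by (simp add: M_empty)
    then show ?case using insert by simp
  qed
  then show ?thesis using finite_subset[OF roots_obs finite_obs] by blast
qed

text \<open>Clipping secures positivity for one vertex at a time; the product form of
  \<open>M_inputs\<close> turns this into positivity of the joint input value.\<close>

lemma M_inputs_assign: "0 < M (inputs G) (assign x y)"
proof -
  have "0 < M {Orig v} (assign x y)" if "v \<in> roots G" for v
  proof -
    have "Orig v \<in> V" using that inputs_V by blast
    moreover from this have "M {Orig v} (assign x y) = M {Orig v} (\<lambda>_. clip (Orig v) (y v))"
      using that by (intro marginal_cong) (simp add: assign_def)
    ultimately show ?thesis using clip(2) by simp
  qed
  then show ?thesis
    unfolding M_inputs[OF assign_PiE] using c_pos by (simp add: prod_pos)
qed

lemma M_inputs_sub_assign: "C \<subseteq> inputs G \<Longrightarrow> 0 < M C (assign x y)"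
  using M_inputs_assign M_antimono less_le_trans by blast

section \<open>The assumptions of \<open>split_kernel\<close> for the conditional kernel\<close>

lemma Q_cong_out:
  assumes "S \<subseteq> obs G" "\<And>v. v \<in> S \<Longrightarrow> x v = x' v"
  shows "Q S x y = Q S x' y"
proof -
  have "M {Orig v} (x \<circ> base) = M {Orig v} (x' \<circ> base)" if "v \<in> S \<inter> roots G" for v
    using assms that by (intro marginal_cong) auto
  moreover have "M (Orig ` (S - roots G) \<union> inputs G) (assign x y) = M (Orig ` (S - roots G) \<union> inputs G) (assign x' y)"
    "M (inputs G) (assign x y) = M (inputs G) (assign x' y)"
    using assms by (auto intro!: marginal_cong simp: assign_def)
  ultimately show ?thesis unfolding Q_def by simp
qed

text \<open>\<open>assign\<close> never reads \<open>x\<close> at a root, so for a root the sum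
  meets only the factor \<open>M {Orig v}\<close> and gives one. A nonroot is a coordinate of the
  numerator alone, and \<open>sum_marginal\<close> removes it.\<close>

lemma Q_sum:
  assumes "S \<subseteq> obs G" "v \<in> S"
  shows "(\<Sum>a\<in>alph G v. Q S (x(v := a)) y) = Q (S - {v}) x y"
proof -
  have vV: "Orig v \<in> V" using assms V_eq by blast
  have fin: "finite S" using assms finite_obs finite_subset by blast
  have I: "M (inputs G) (assign (x(v := a)) y) = M (inputs G) (assign x y)" for a
    by (intro marginal_cong) (auto simp: assign_def)
  let ?rest = "\<Prod>u\<in>(S - {v}) \<inter> roots G. M {Orig u} (x \<circ> base)"
  have rest: "(\<Prod>u\<in>(S - {v}) \<inter> roots G. M {Orig u} (x(v := a) \<circ> base)) = ?rest" for a
    by (intro prod.cong refl marginal_cong) auto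
  show ?thesis
  proof (cases "v \<in> roots G")
    case True
    have S: "S \<inter> roots G = insert v ((S - {v}) \<inter> roots G)" "S - roots G = S - {v} - roots G"
      using True assms by auto
    have "M (Orig ` (S - {v} - roots G) \<union> inputs G) (assign (x(v := a)) y)
        = M (Orig ` (S - {v} - roots G) \<union> inputs G) (assign x y)" for a
      by (intro marginal_cong) (auto simp: assign_def)
    moreover have "M {Orig v} (x(v := a) \<circ> base) = M {Orig v} ((x \<circ> base)(Orig v := a))" for a
      by (intro marginal_cong) auto
    ultimately have "Q S (x(v := a)) y = M {Orig v} ((x \<circ> base)(Orig v := a)) * Q (S - {v}) x y" for a
      unfolding Q_def S I using fin by (simp add: rest)
    then show ?thesis
      using sum_M_single[OF vV, of "x \<circ> base"] by (simp add: sum_distrib_right[symmetric])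
  next
    case False
    have S: "S \<inter> roots G = (S - {v}) \<inter> roots G" using False by blast
    let ?T = "Orig ` (S - {v} - roots G) \<union> inputs G"
    have T: "Orig ` (S - roots G) \<union> inputs G = insert (Orig v) ?T" "Orig v \<notin> ?T"
      using False assms by auto
    \<comment> \<open>For \<open>a\<close> in the alphabet, \<open>assign\<close> takes
      \<open>a\<close> itself rather than the default value.\<close>
    have "M (insert (Orig v) ?T) (assign (x(v := a)) y) = M (insert (Orig v) ?T) ((assign x y)(Orig v := a))"
      if "a \<in> alph G v" for a
      using that False vV by (intro marginal_cong) (auto simp: assign_def)
    then have "(\<Sum>a\<in>alph G v. M (insert (Orig v) ?T) (assign (x(v := a)) y)) = M ?T (assign x y)"
      using sum_marginal[OF finite_PiE_V _ vV T(2), of joint "assign x y"] alph_X[OF vV] by simp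
    then show ?thesis
      unfolding Q_def S T(1) rest I
      by (simp add: sum_distrib_left[symmetric] sum_divide_distrib[symmetric])
  qed
qed

lemma Q_cong_in:
  assumes "S \<subseteq> obs G" "\<And>v. v \<in> pa (mixed_graph_of G) S \<Longrightarrow> y v = y' v"
  shows "Q S x y = Q S x y'"
proof -
  let ?S = "S - roots G"
  \<comment> \<open>The inputs that stand for mixed-graph parents of \<open>S\<close>; given these,
    the remaining inputs are irrelevant to the nonroots of \<open>S\<close>.\<close>
  define C where "C = {i \<in> inputs G. base i \<in> pa (mixed_graph_of G) S}"
  have C: "C \<subseteq> inputs G" unfolding C_def by blast
  have dsep: "d_separated (edges (VVSplit G)) (Orig ` ?S) (inputs G - C) C"
  proof (rule d_separated_nonparents[OF dag _ C])
    show "?S \<subseteq> obs G - roots G" using assms by blast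
    fix i v assume i: "i \<in> inputs G - C" and v: "v \<in> ?S"
    show "(base i, v) \<notin> latent_paths G"
    proof
      assume l: "(base i, v) \<in> latent_paths G"
      \<comment> \<open>Edges of the mixed graph join distinct vertices, so acyclicity has to
        exclude a loop at \<open>v\<close>.\<close>
      then have "base i \<noteq> v"
        using latent_paths_trancl dag unfolding causal_dag_def acyclic_def by metis
      moreover have "base i \<in> obs G" using i roots_obs split_obs by auto
      ultimately have "base i \<in> pa (mixed_graph_of G) S"
        using l v assms(1) unfolding pa_def mixed_graph_of_def by auto
      then show False using i unfolding C_def by blast
    qed
  qed
  have S: "Orig ` ?S \<subseteq> V" "Orig ` ?S \<inter> inputs G = {}" using assms(1) V_eq by auto
  have sets: "A \<inter> (I - C) = {}" "A \<inter> C = {}" "(I - C) \<inter> C = {}" "A \<union> (I - C) \<union> C = A \<union> I"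
      "(I - C) \<union> C = I"
    if "A \<inter> I = {}" "C \<subseteq> I" for A I C :: "'v split_vertex set"
    using that by blast+
  note sets = sets[OF S(2) C]
  have ind: "M (Orig ` ?S \<union> (inputs G - C) \<union> C) (assign x y) / M C (assign x y) =
      (M (Orig ` ?S \<union> C) (assign x y) / M C (assign x y)) *
      (M (inputs G - C \<union> C) (assign x y) / M C (assign x y))" for y
    by (rule M_indep[OF S(1) subset_trans[OF Diff_subset inputs_V] subset_trans[OF C inputs_V]
          sets(1-3) dsep assign_PiE M_inputs_sub_assign[OF C]])
  \<comment> \<open>Cancelling the positive masses of \<open>C\<close> and of all inputs in
    \<open>ind\<close> reduces conditioning on all inputs to conditioning on
    \<open>C\<close>.\<close>
  have *: "M (Orig ` ?S \<union> inputs G) (assign x y) / M (inputs G) (assign x y) =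
      M (Orig ` ?S \<union> C) (assign x y) / M C (assign x y)" for y
    using ind[of y, unfolded sets(4,5)] M_inputs_assign[of x y] M_inputs_sub_assign[OF C, of x y]
    by (simp add: field_simps)
  have "assign x y i = assign x y' i" if "i \<in> Orig ` ?S \<union> C" for i
    using that assms(2) unfolding assign_def C_def by auto
  then have "M A (assign x y) = M A (assign x y')" if "A \<subseteq> Orig ` ?S \<union> C" for A
    using that by (intro marginal_cong) blast
  from this[of "Orig ` ?S \<union> C"] this[of C]
  have "M (Orig ` ?S \<union> C) (assign x y) = M (Orig ` ?S \<union> C) (assign x y')"
    "M C (assign x y) = M C (assign x y')"
    by simp_all
  then show ?thesis unfolding Q_def * by simp
qed

text \<open>A common latent source of a vertex of \<open>S\<close> and one of \<open>T\<close> would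
  give a bidirected edge. So the nonroots of both sets are independent given all inputs, and the
  root product splits by disjointness.\<close>

lemma Q_indep:
  assumes "S \<subseteq> obs G" "T \<subseteq> obs G" "S \<inter> T = {}" "bidir (mixed_graph_of G) \<inter> S \<times> T = {}"
  shows "Q (S \<union> T) x y = Q S x y * Q T x y"
proof -
  let ?S = "S - roots G" and ?T = "T - roots G"
  have "d_separated (edges (VVSplit G)) (Orig ` ?S) (Orig ` ?T) (inputs G)"
  proof (rule d_separated_districts[OF dag])
    show "?S \<subseteq> obs G - roots G" "?T \<subseteq> obs G - roots G" "?S \<inter> ?T = {}" using assms by auto
    fix s t w assume "s \<in> ?S" "t \<in> ?T" "w \<in> lat G" "(w, s) \<in> latent_paths G"
    moreover from this have "(s, t) \<notin> bidir (mixed_graph_of G)" "s \<noteq> t" using assms by auto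
    ultimately show "(w, t) \<notin> latent_paths G"
      using assms(1,2) unfolding mixed_graph_of_def by auto
  qed
  moreover have "Orig ` ?S \<subseteq> V" "Orig ` ?S \<inter> inputs G = {}" "Orig ` ?T \<subseteq> V" "Orig ` ?T \<inter> inputs G = {}"
    "Orig ` ?S \<inter> Orig ` ?T = {}"
    using assms V_eq by auto
  ultimately have "M (Orig ` ?S \<union> Orig ` ?T \<union> inputs G) (assign x y) / M (inputs G) (assign x y) =
      (M (Orig ` ?S \<union> inputs G) (assign x y) / M (inputs G) (assign x y)) *
      (M (Orig ` ?T \<union> inputs G) (assign x y) / M (inputs G) (assign x y))"
    using inputs_V by (intro M_indep assign_PiE M_inputs_assign)
  moreover have "Orig ` (S \<union> T - roots G) = Orig ` ?S \<union> Orig ` ?T" by blast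
  moreover have "(\<Prod>v\<in>(S \<union> T) \<inter> roots G. M {Orig v} (x \<circ> base)) =
      (\<Prod>v\<in>S \<inter> roots G. M {Orig v} (x \<circ> base)) * (\<Prod>v\<in>T \<inter> roots G. M {Orig v} (x \<circ> base))"
    unfolding Int_Un_distrib2 using assms finite_obs
    by (intro prod.union_disjoint) (auto intro: finite_subset)
  ultimately show ?thesis unfolding Q_def by simp
qed

text \<open>If every root value has positive probability, nothing is clipped, and the root marginals
  and \<open>c\<close> cancel against \<open>M_inputs\<close>, leaving \<open>q\<close>. Otherwise
  the root product and \<open>q\<close> both vanish.\<close>

lemma Q_diagonal:
  assumes "x \<in> Pi\<^sub>E (obs G) (alph G)"
  shows "Q (obs G) x x = Proj G q x"
proof -
  \<comment> \<open>Both copies of every split vertex receive the value of \<open>x\<close>.\<close>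
  define z where "z = restrict (x \<circ> base) V"
  have "restrict (case_split_vertex x x) V = z"
    unfolding z_def by (intro restrict_ext) (auto split: split_vertex.splits)
  then have proj: "Proj G q x = q z" using assms unfolding Proj_def by simp
  have z: "z \<in> Pi\<^sub>E V X"
    unfolding z_def V_eq using assms split_obs by (auto simp: VVSplit_def)
  have root: "M {Orig v} (x \<circ> base) = M {Orig v} z" if "v \<in> roots G" for v
    using that roots_obs V_eq by (intro marginal_cong) (auto simp: z_def)
  have R: "obs G \<inter> roots G = roots G" using roots_obs by blast
  have all: "Orig ` (obs G - roots G) \<union> inputs G = V" using V_eq roots_obs by auto
  show ?thesis
  proof (cases "\<forall>v\<in>roots G. 0 < M {Orig v} z")
    case True
    have "clip i (x (base i)) = z i" if i: "i \<in> inputs G" for i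
    proof -
      have iV: "i \<in> V" using i inputs_V by blast
      have "M {i} (\<lambda>_. x (base i)) = M {i} z" using iV by (intro marginal_cong) (simp add: z_def)
      moreover have "0 < M {i} z"
      proof (cases i)
        case (Orig v)
        then show ?thesis using i True by auto
      next
        case (Sharp v)
        \<comment> \<open>A single sharp value is at least as likely as the joint sharp value, which
          has mass \<open>c\<close>.\<close>
        then have "M sharps z \<le> M {i} z" using i by (intro M_antimono) auto
        then show ?thesis using M_sharps[OF z] c_pos by simp
      qed
      moreover have "x (base i) \<in> X i" using z iV by (auto simp: z_def)
      ultimately show ?thesis unfolding clip_def z_def using iV by simp
    qed
    moreover have "x (base i) \<in> X i" if "i \<in> V" for i using z that by (auto simp: z_def)
    ultimately have "assign x x = z"
      unfolding assign_def by (auto simp: z_def fun_eq_iff)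
    moreover have "joint z = c * q z" using z by (simp add: joint_def)
    moreover have "(\<Prod>v\<in>roots G. M {Orig v} z) > 0" using True by (simp add: prod_pos)
    ultimately show ?thesis
      using c_pos root \<open>joint z = c * q z\<close>
      by (simp add: Q_def R all proj M_inputs[OF z] marginal_full[OF z])
  next
    case False
    then obtain v where v: "v \<in> roots G" "M {Orig v} z \<le> 0" by force
    have "Orig v \<in> V" using v roots_obs V_eq by blast
    then have "M V z \<le> M {Orig v} z" by (intro M_antimono) auto
    then have "joint z = 0" "M {Orig v} z = 0"
      using v joint_nonneg[OF z] marginal_full[OF z, of joint] by simp_all
    then have "q z = 0" using c_pos z unfolding joint_def by simp
    moreover have "(\<Prod>v\<in>roots G. M {Orig v} (x \<circ> base)) = 0"
      using v root \<open>M {Orig v} z = 0\<close> finite_subset[OF roots_obs finite_obs] by (intro prod_zero) auto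
    ultimately show ?thesis unfolding Q_def R proj by simp
  qed
qed

section \<open>Transfer to the nested Markov model\<close>

lemma random_mixed_graph: "random (mixed_graph_of G) = obs G"
  by (simp add: mixed_graph_of_def)

sublocale split_kernel "alph G" "mixed_graph_of G" Q
proof
  note r = random_mixed_graph
  show "finite (random (mixed_graph_of G))" unfolding r by (rule finite_obs)
  show "fixd (mixed_graph_of G) = {}" by (simp add: mixed_graph_of_def)
  show "dir (mixed_graph_of G) \<subseteq> random (mixed_graph_of G) \<times> random (mixed_graph_of G)"
    "bidir (mixed_graph_of G) \<subseteq> random (mixed_graph_of G) \<times> random (mixed_graph_of G)"
    by (auto simp: mixed_graph_of_def)
  have "dir (mixed_graph_of G) \<subseteq> (edges G)\<^sup>+"
    using latent_paths_trancl by (auto simp: mixed_graph_of_def)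
  moreover have "acyclic ((edges G)\<^sup>+)" using dag unfolding causal_dag_def acyclic_def by simp
  ultimately show "acyclic (dir (mixed_graph_of G))" by (rule acyclic_subset[rotated])
  show "sym (bidir (mixed_graph_of G))" by (auto simp: mixed_graph_of_def sym_def)
  show "0 \<le> Q S x y" for S x y
    unfolding Q_def by (intro mult_nonneg_nonneg prod_nonneg divide_nonneg_nonneg ballI M_nonneg)
  show "Q {} x y = 1" for x y
    unfolding Q_def using M_inputs_assign[of x y] by simp
  show "finite (alph G v)" if "v \<in> random (mixed_graph_of G)" for v
    using that dag unfolding r causal_dag_def by blast
qed (unfold random_mixed_graph, fact Q_sum, fact Q_cong_out, fact Q_cong_in, fact Q_indep)

lemma Proj_NM: "Proj G q \<in> NM G"
proof -
  have "Proj G q = (\<lambda>x\<in>Pi\<^sub>E (obs G) (alph G). Q (obs G) x x)"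
    using Q_diagonal by (auto simp: fun_eq_iff Proj_def)
  then show ?thesis
    using nested_markov_diagonal diagonal_distribution unfolding NM_def random_mixed_graph by simp
qed

end

theorem lemma2:
  fixes G :: "('v, 'a) causal_dag"
  assumes "causal_dag G"
  shows "VVS G \<subseteq> NM G"
proof
  fix p assume "p \<in> VVS G"
  then obtain q where p: "p = Proj G q" "q \<in> markov_kernels (VVSplit G) (Sharp ` split_vertices G)"
    unfolding VVS_def by blast
  interpret split_markov G q using assms p(2) by unfold_locales
  show "p \<in> NM G" unfolding p(1) by (rule Proj_NM)
qed

end
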